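(* Let $M$ be a positive integer congruent to $3$, $4$ or $5$ modulo $8$, and let $n\ge 1$ and $k\ge 0$ be integers. The number of partitions of $n$ into parts congruent to $3$, $4$ or $5$ modulo $8$ in which the part $M$ occurs exactly $k$ times is equal to the number of partitions $\lambda=(\lambda_1\ge\lambda_2\ge\cdots)$ of $n$ into parts whose difference is at least $2$, greater than $2$ for consecutive even parts, with smallest part at least $3$, such that: (1) if $\lambda$ has a single part, then $n=Mk$, or $n=Mk+j$ for some integer $j$ with $3\le j\le M+2$, $j\neq M$; (2) if $\lambda$ has at least two parts and the second part $\lambda_2$ is even, then $\lfloor (\lambda_1-\lambda_2-3)/M\rfloor=k$; (3) if $\lambda$ has at least two parts and the second part $\lambda_2$ is odd, then $\lfloor(\lambda_1-\lambda_2-2)/M\rfloor=k$.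
   Context: The phrase "parts whose difference is at least $2$, greater than $2$ for consecutive even parts" means: $\lambda_i-\lambda_{i+1}\ge 2$ for every pair of successive parts, and $\lambda_i-\lambda_{i+1}>2$ whenever $\lambda_i$ and $\lambda_{i+1}$ are both even. *)

theory Defs
  imports Complex_Main
begin

text \<open>
  A partition is the list of its parts in weakly decreasing order, so that
  \<open>xs ! 0\<close>, \<open>xs ! 1\<close>, \<dots> are the largest part, the second part, and so on.
\<close>

definition partitions :: "nat \<Rightarrow> nat list set" where
  "partitions n = {xs. sorted_wrt (\<ge>) xs \<and> (\<forall>x \<in> set xs. 0 < x) \<and> sum_list xs = n}"

lemma finite_partitions: "finite (partitions n)"
proof (rule finite_subset)
  have "length xs \<le> sum_list xs" if "\<forall>x \<in> set xs. 0 < x" for xs :: "nat list"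
    using that by (induction xs) auto
  then show "partitions n \<subseteq> {xs. set xs \<subseteq> {..n} \<and> length xs \<le> n}"
    by (auto simp: partitions_def intro: member_le_sum_list)
  show "finite {xs. set xs \<subseteq> {..n} \<and> length xs \<le> n}"
    by (rule finite_lists_length_le) simp
qed

definition gap_condition :: "nat list \<Rightarrow> bool" where
  "gap_condition xs \<longleftrightarrow>
     (\<forall>i. Suc i < length xs \<longrightarrow>
        int (xs ! i) - int (xs ! Suc i) \<ge> 2 \<and>
        (even (xs ! i) \<and> even (xs ! Suc i) \<longrightarrow> int (xs ! i) - int (xs ! Suc i) > 2))"

end

theory Submission
  imports Defs "HOL-Computational_Algebra.Formal_Power_Series"
begin

text \<open>
  Removing copies of \<open>M\<close> shows that the partitions of \<open>n\<close> into parts 3, 4, 5 modulo 8 with exactly \<open>k\<close> parts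
  \<open>M\<close> number \<open>P(n - Mk) - P(n - Mk - M)\<close>, where \<open>P\<close> counts all partitions into such parts
  (\<open>card_partitions_into_count_ge\<close>). In a partition with the gap condition the largest part may be any number
  from a bound on that depends on the second part only. So the excess over this bound can be lowered freely, and
  the partitions whose excess lies between \<open>Mk\<close> and \<open>Mk + M - 1\<close> are counted by the same kind of difference
  (\<open>card_gap_partitions_first_gap\<close>). The condition on single parts accounts for the partitions of length at most 1.
  It remains to know that \<open>P(n)\<close> also counts the partitions of \<open>n\<close> with the gap condition and parts at least 3,
  which is the second Goellnitz-Gordon identity (\<open>goellnitz_gordon\<close>).

  Let \<open>a\<^sub>m\<close> be the generating function of the partitions with the gap condition and parts at least \<open>2m + 3\<close>.
  Splitting by the smallest part gives
  \<open>a\<^sub>m = (1 + q\<^sup>2\<^sup>m\<^sup>+\<^sup>3) a\<^sub>m\<^sub>+\<^sub>1 + q\<^sup>2\<^sup>m\<^sup>+\<^sup>4 a\<^sub>m\<^sub>+\<^sub>2\<close>, and \<open>a\<^sub>m\<close> tends to 1. These two properties determine the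
  sequence. A second solution of the recurrence is the alternating sum \<open>bailey_sum\<close>, which Bailey's lemma suggests;
  that it satisfies the recurrence is verified term by term with a telescoping certificate
  (\<open>bailey_term_recurrence\<close>). Its limit is \<open>(q\<^sup>2; q\<^sup>2)\<^sub>\<infinity> / (-q; q\<^sup>2)\<^sub>\<infinity>\<close>, so it is \<open>a\<^sub>m\<close> times this quotient. At
  \<open>m = 0\<close> it is the theta series \<open>\<Sum>j. (-1)\<^sup>j q^(4j\<^sup>2 + 3j)\<close> over all integers \<open>j\<close>, which the Jacobi triple product turns
  into \<open>(q, q\<^sup>7, q\<^sup>8; q\<^sup>8)\<^sub>\<infinity>\<close>; dividing by the quotient leaves the product over the residues 3, 4, 5.

  All infinite sums and products are replaced by finite ones and all equations by congruences modulo
  \<open>q\<^sup>N\<close> for arbitrary \<open>N\<close>. In particular the triple product is used in a finite form that follows from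
  the \<open>q\<close>-binomial theorem.
\<close>

section \<open>Congruences in commutative rings and power series\<close>

definition eqmod :: "'a::comm_ring_1 \<Rightarrow> 'a \<Rightarrow> 'a \<Rightarrow> bool" where
  "eqmod d a b \<longleftrightarrow> d dvd a - b"

lemma eqmod_refl [simp]: "eqmod d a a"
  by (simp add: eqmod_def)

lemma eqmod_sym: "eqmod d a b \<Longrightarrow> eqmod d b a"
  by (metis eqmod_def dvd_minus_iff minus_diff_eq)

lemma eqmod_trans [trans]: "eqmod d a b \<Longrightarrow> eqmod d b c \<Longrightarrow> eqmod d a c"
  using dvd_add[of d "a - b" "b - c"] by (simp add: eqmod_def)

lemma eqmod_eq_trans [trans]: "eqmod d a b \<Longrightarrow> b = c \<Longrightarrow> eqmod d a c"
  by simp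

lemma eq_eqmod_trans [trans]: "a = b \<Longrightarrow> eqmod d b c \<Longrightarrow> eqmod d a c"
  by simp

lemma eqmod_add: "eqmod d a b \<Longrightarrow> eqmod d a' b' \<Longrightarrow> eqmod d (a + a') (b + b')"
  using dvd_add[of d "a - b" "a' - b'"] by (simp add: eqmod_def algebra_simps)

lemma eqmod_diff: "eqmod d a b \<Longrightarrow> eqmod d a' b' \<Longrightarrow> eqmod d (a - a') (b - b')"
  using dvd_diff[of d "a - b" "a' - b'"] by (simp add: eqmod_def algebra_simps)

lemma eqmod_mult:
  assumes "eqmod d a b" "eqmod d a' b'" shows "eqmod d (a * a') (b * b')"
proof -
  have "a * a' - b * b' = (a - b) * a' + b * (a' - b')" by (simp add: algebra_simps)
  then show ?thesis using assms by (simp add: eqmod_def)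
qed

lemma eqmod_sum: "(\<And>x. x \<in> S \<Longrightarrow> eqmod d (f x) (g x)) \<Longrightarrow> eqmod d (sum f S) (sum g S)"
  by (simp add: eqmod_def dvd_sum flip: sum_subtractf)

lemma eqmod_prod: "(\<And>x. x \<in> S \<Longrightarrow> eqmod d (f x) (g x)) \<Longrightarrow> eqmod d (prod f S) (prod g S)"
  by (induction S rule: infinite_finite_induct) (auto intro: eqmod_mult)

lemma eqmod_prod_1: "(\<And>x. x \<in> S \<Longrightarrow> eqmod d (f x) 1) \<Longrightarrow> eqmod d (prod f S) 1"
  using eqmod_prod[of S d f "\<lambda>_. 1"] by simp

lemma eqmod_unit_cancel:
  assumes "u dvd 1" "eqmod d (u * a) (u * b)" shows "eqmod d a b"
proof -
  have dv: "d dvd u * (a - b)" using assms(2) by (simp add: eqmod_def right_diff_distrib)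
  obtain v where "1 = u * v" using assms(1) by (elim dvdE)
  then have "a - b = v * (u * (a - b))" by (metis mult.assoc mult.commute mult_1)
  then show ?thesis using dvd_mult[OF dv, of v] by (simp add: eqmod_def)
qed

lemma eqmod_weaken: "d dvd d' \<Longrightarrow> eqmod d' a b \<Longrightarrow> eqmod d a b"
  unfolding eqmod_def by (rule dvd_trans)

lemma eqmod_0_iff: "eqmod d a 0 \<longleftrightarrow> d dvd a"
  by (simp add: eqmod_def)

text \<open>
  The counting series have integer coefficients; over the field of rationals, every power series with
  nonzero constant term has an inverse, which the denominators below require.
\<close>

abbreviation q :: "rat fps" where "q \<equiv> fps_X"

lemma eqmod_fps_iff: "eqmod (q ^ N) a b \<longleftrightarrow> (\<forall>i<N. fps_nth a i = fps_nth b i)"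
proof
  assume "eqmod (q ^ N) a b"
  then obtain c where "a - b = q ^ N * c" by (auto simp: eqmod_def elim: dvdE)
  then have "fps_nth (a - b) i = 0" if "i < N" for i using that by (simp add: fps_X_power_mult_nth)
  then show "\<forall>i<N. fps_nth a i = fps_nth b i" by simp
next
  assume "\<forall>i<N. fps_nth a i = fps_nth b i"
  then have "fps_cutoff N (a - b) = 0" by (simp add: fps_eq_iff)
  then have "a - b = q ^ N * fps_shift N (a - b)"
    using fps_shift_cutoff'[of N "a - b"] by simp
  then show "eqmod (q ^ N) a b" unfolding eqmod_def by (metis dvd_triv_left)
qed

lemma fps_dvd_1_if_constant_term_1: "fps_nth a 0 = 1 \<Longrightarrow> (a :: rat fps) dvd 1"
  by (metis dvd_triv_left fps_one_nth inverse_mult_eq_1' one_neq_zero)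

section \<open>A telescoping recurrence for the Bailey sum\<close>

text \<open>
  In the usual notation these are \<open>(q\<^sup>2\<^sup>n\<^sup>+\<^sup>2; q\<^sup>2)\<^sub>m\<close> and \<open>(-q\<^sup>2\<^sup>n\<^sup>+\<^sup>1; q\<^sup>2)\<^sub>m\<close>. As every factor
  has constant term 1, so have both products, and they are units.
\<close>

definition evenprod :: "nat \<Rightarrow> nat \<Rightarrow> rat fps" where
  "evenprod n m = (\<Prod>i<m. 1 - q ^ (2 * (n + i) + 2))"

definition oddprod :: "nat \<Rightarrow> nat \<Rightarrow> rat fps" where
  "oddprod n m = (\<Prod>i<m. 1 + q ^ (2 * (n + i) + 1))"

lemma evenprod_Suc: "evenprod n (Suc m) = evenprod n m * (1 - q ^ (2 * (n + m) + 2))"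
  by (simp add: evenprod_def)

lemma evenprod_shift: "evenprod n (Suc m) = (1 - q ^ (2 * n + 2)) * evenprod (Suc n) m"
  by (simp add: evenprod_def prod.lessThan_Suc_shift del: prod.lessThan_Suc)

lemma oddprod_Suc: "oddprod n (Suc m) = oddprod n m * (1 + q ^ (2 * (n + m) + 1))"
  by (simp add: oddprod_def)

lemma oddprod_shift: "oddprod n (Suc m) = (1 + q ^ (2 * n + 1)) * oddprod (Suc n) m"
  by (simp add: oddprod_def prod.lessThan_Suc_shift del: prod.lessThan_Suc)

lemma prod_nth_0: "fps_nth (prod f S :: rat fps) 0 = (\<Prod>x\<in>S. fps_nth (f x) 0)"
  by (induction S rule: infinite_finite_induct) auto

lemma oddprod_nth_0: "fps_nth (oddprod n m) 0 = 1"
  by (simp add: oddprod_def prod_nth_0)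

lemma evenprod_nth_0: "fps_nth (evenprod n m) 0 = 1"
  by (simp add: evenprod_def prod_nth_0)

lemma inverse_oddprod: "oddprod n m * inverse (oddprod n m) = 1"
  by (rule inverse_mult_eq_1') (simp add: oddprod_nth_0)

lemma inverse_oddprod_Suc:
  "inverse (oddprod n m) = inverse (oddprod n (Suc m)) * (1 + q ^ (2 * (n + m) + 1))"
  (is "?l = ?r * ?c")
proof -
  have "?l = ?l * (oddprod n (Suc m) * ?r)" by (simp add: inverse_oddprod)
  also have "\<dots> = (oddprod n m * ?l) * (?r * ?c)" by (simp only: oddprod_Suc mult_ac)
  finally show ?thesis by (simp add: inverse_oddprod)
qed

lemma inverse_oddprod_shift:
  "inverse (oddprod (Suc n) m) = inverse (oddprod n (Suc m)) * (1 + q ^ (2 * n + 1))"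
  (is "?l = ?r * ?c")
proof -
  have "?l = ?l * (oddprod n (Suc m) * ?r)" by (simp add: inverse_oddprod)
  also have "\<dots> = (oddprod (Suc n) m * ?l) * (?r * ?c)" by (simp only: oddprod_shift mult_ac)
  finally show ?thesis by (simp add: inverse_oddprod)
qed

text \<open>
  With \<open>a = q\<^sup>2\<^sup>m\<^sup>+\<^sup>2\<close>, this is the \<open>n\<close>-th term of the series that Bailey's lemma produces from
  \<open>\<Sum>n. a\<^sup>n q^(n\<^sup>2) (-q; q\<^sup>2)\<^sub>n / (q\<^sup>2; q\<^sup>2)\<^sub>n\<close>, multiplied by \<open>(q\<^sup>2; q\<^sup>2)\<^sub>\<infinity> / (-q; q\<^sup>2)\<^sub>\<infinity>\<close>. The
  multiplication turns the infinite products in \<open>m\<close> and \<open>n\<close> into finite ones.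
\<close>

definition bailey_term :: "nat \<Rightarrow> nat \<Rightarrow> rat fps" where
  "bailey_term m n = (-1) ^ n * q ^ (4*n*n + 3*n + 4*m*n) * (1 - q ^ (2*m + 2 + 4*n))
     * evenprod n m * inverse (oddprod n (m + 1))"

text \<open>
  The last factor is the polynomial \<open>x y\<^sup>2 - (1 + x q) y - 1\<close> in \<open>x = q\<^sup>2\<^sup>m\<^sup>+\<^sup>2\<close> and
  \<open>y = q\<^sup>2\<^sup>n\<close>. It comes from comparing coefficients of \<open>y\<close> in the identity
  \<open>bailey_term_polynomial_identity\<close> with an unknown quadratic in its place. The factor \<open>1 - y\<close>
  makes the telescoper vanish at \<open>n = 0\<close>.
\<close>

definition telescoper :: "nat \<Rightarrow> nat \<Rightarrow> rat fps" where
  "telescoper m n = (-1) ^ n * q ^ (4*n*n + 3*n + 4*m*n) * evenprod n m * inverse (oddprod n (m + 2))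
     * (1 - q ^ (2*n)) * (q ^ (2*m + 2 + 4*n) - (1 + q ^ (2*m + 3)) * q ^ (2*n) - 1)"

text \<open>
  This is what remains of \<open>bailey_term_recurrence\<close> once the common factor of its five terms has been
  removed.
\<close>

lemma bailey_term_polynomial_identity:
  fixes x y q :: "'a::comm_ring_1"
  shows "(1 - x*y\<^sup>2) * (1 + x*y*q) * (1 + x*y*q^3)
     - (1 + x*q) * (y\<^sup>2 * (1 - x*q\<^sup>2*y\<^sup>2) * (1 - x*y) * (1 + x*y*q^3))
     - x*q\<^sup>2 * (y^4 * (1 - x*q^4*y\<^sup>2) * (1 - x*y) * (1 - x*y*q\<^sup>2))
   = - (x\<^sup>2*y^4*q^3 * (1 - x*y) * (1 + q*y) * (x*(q\<^sup>2*y)\<^sup>2 - (1 + x*q)*(q\<^sup>2*y) - 1))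
     - (1 - y) * (1 + x*y*q^3) * (x*y\<^sup>2 - (1 + x*q)*y - 1)"
  by (simp add: algebra_simps eval_nat_numeral)

text \<open>
  In each of the five terms the products over \<open>n\<close> and \<open>m\<close> differ from those of \<open>s * E * I\<close> below only
  by a few boundary factors. Taking \<open>m + 3\<close> denominator factors into \<open>I\<close> covers all five terms, so that the
  cofactors are polynomials in \<open>x\<close>, \<open>y\<close> and \<open>q\<close>.
\<close>

lemma bailey_term_recurrence:
  "bailey_term m n - (1 + q ^ (2*m + 3)) * bailey_term (m + 1) n - q ^ (2*m + 4) * bailey_term (m + 2) n
    = telescoper m (n + 1) - telescoper m n"
proof -
  define x where "x = q ^ (2*m + 2)"
  define y where "y = q ^ (2*n)"
  define s where "s = (-1) ^ n * q ^ (4*n*n + 3*n + 4*m*n)"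
  define E where "E = evenprod n m"
  define I where "I = inverse (oddprod n (m + 3))"
  have I2: "inverse (oddprod n (m + 2)) = I * (1 + x*y*q^3)"
    using inverse_oddprod_Suc[of n "m + 2"]
    by (simp add: I_def x_def y_def eval_nat_numeral flip: power_add power_Suc power_Suc2 mult.assoc)
  have I1: "inverse (oddprod n (m + 1)) = I * (1 + x*y*q^3) * (1 + x*y*q)"
    using inverse_oddprod_Suc[of n "m + 1"] I2
    by (simp add: x_def y_def eval_nat_numeral flip: power_add power_Suc power_Suc2 mult.assoc)
  have I2': "inverse (oddprod (n + 1) (m + 2)) = I * (1 + q*y)"
    using inverse_oddprod_shift[of n "m + 2"]
    by (simp add: I_def y_def eval_nat_numeral flip: power_add power_Suc power_Suc2 mult.assoc)
  have E1: "evenprod n (m + 1) = E * (1 - x*y)"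
    by (simp add: evenprod_Suc E_def x_def y_def algebra_simps flip: power_add power_Suc)
  have E2: "evenprod n (m + 2) = E * (1 - x*y) * (1 - x*y*q\<^sup>2)"
  proof -
    have "q ^ (2 * (n + (m + 1)) + 2) = x*y*q\<^sup>2"
      by (simp add: x_def y_def algebra_simps flip: power_add)
    then show ?thesis using E1 evenprod_Suc[of n "m + 1"] by simp
  qed
  have E1': "(1 - q\<^sup>2*y) * evenprod (n + 1) m = E * (1 - x*y)"
    using E1 evenprod_shift[of n m]
    by (simp add: y_def algebra_simps flip: power_add power_Suc)
  have t0: "bailey_term m n = s * E * I * ((1 - x*y\<^sup>2) * (1 + x*y*q) * (1 + x*y*q^3))"
  proof -
    have "q ^ (2*m + 2 + 4*n) = x*y\<^sup>2" by (simp add: x_def y_def flip: power_add power_mult)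
    then show ?thesis unfolding bailey_term_def I1 by (simp add: s_def E_def mult_ac)
  qed
  have t1: "bailey_term (m+1) n = s * E * I * (y\<^sup>2 * (1 - x*q\<^sup>2*y\<^sup>2) * (1 - x*y) * (1 + x*y*q^3))"
  proof -
    have *: "q ^ (2*(m+1) + 2 + 4*n) = x*q\<^sup>2*y\<^sup>2"
      by (simp add: x_def y_def flip: power_add power_mult)
    have **: "(-1) ^ n * q ^ (4*n*n + 3*n + 4*(m+1)*n) = s * y\<^sup>2"
      by (simp add: s_def y_def algebra_simps flip: power_add power_mult)
    have ***: "inverse (oddprod n (m + 1 + 1)) = I * (1 + x*y*q^3)" using I2 by simp
    show ?thesis unfolding bailey_term_def * ** E1 *** by (simp add: mult_ac)
  qed
  have t2: "bailey_term (m+2) n = s * E * I * (y^4 * (1 - x*q^4*y\<^sup>2) * (1 - x*y) * (1 - x*y*q\<^sup>2))"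
  proof -
    have *: "q ^ (2*(m+2) + 2 + 4*n) = x*q^4*y\<^sup>2"
      unfolding x_def y_def power_mult [symmetric] power_add [symmetric]
      by (intro arg_cong[where f = "power q"]) simp
    have **: "(-1) ^ n * q ^ (4*n*n + 3*n + 4*(m+2)*n) = s * y^4"
      by (simp add: s_def y_def algebra_simps flip: power_add power_mult)
    have ***: "inverse (oddprod n (m + 2 + 1)) = I" by (simp add: I_def eval_nat_numeral)
    show ?thesis unfolding bailey_term_def * ** E2 *** by (simp add: mult_ac)
  qed
  have g0: "telescoper m n = s * E * I * ((1 - y) * (1 + x*y*q^3) * (x*y\<^sup>2 - (1 + x*q)*y - 1))"
  proof -
    have *: "q ^ (2*m + 2 + 4*n) = x*y\<^sup>2" "q ^ (2*m + 3) = x * q" "q ^ (2*n) = y"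
      unfolding x_def y_def power_mult_distrib power_mult [symmetric] power_add [symmetric]
        power_Suc2 [symmetric] by (simp_all add: algebra_simps eval_nat_numeral)
    show ?thesis unfolding telescoper_def * I2 s_def [symmetric] E_def [symmetric] by (simp only: mult_ac)
  qed
  have g1: "telescoper m (n+1) = s * E * I *
      (- (x\<^sup>2*y^4*q^3 * (1 - x*y) * (1 + q*y) * (x*(q\<^sup>2*y)\<^sup>2 - (1 + x*q)*(q\<^sup>2*y) - 1)))"
  proof -
    have *: "q ^ (2*m + 2 + 4*(n+1)) = x*(q\<^sup>2*y)\<^sup>2" "q ^ (2*m + 3) = x * q" "q ^ (2*(n+1)) = q\<^sup>2*y"
      unfolding x_def y_def power_mult_distrib power_mult [symmetric] power_add [symmetric]
        power_Suc2 [symmetric] by (simp_all add: algebra_simps eval_nat_numeral)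
    have "q ^ (4*(n+1)*(n+1) + 3*(n+1) + 4*m*(n+1)) = q ^ (4*n*n + 3*n + 4*m*n) * (x\<^sup>2*y^4*q^3)"
      unfolding x_def y_def power_mult [symmetric] power_add [symmetric]
      by (intro arg_cong[where f = "power q"]) (simp add: algebra_simps)
    then have **: "(-1) ^ (n+1) * q ^ (4*(n+1)*(n+1) + 3*(n+1) + 4*m*(n+1)) = - s * (x\<^sup>2*y^4*q^3)"
      by (simp only: s_def power_add power_one_right mult_minus_right mult_minus_left mult_1_right mult_1_left mult.assoc)
    have "telescoper m (n+1) = - s * (x\<^sup>2*y^4*q^3) * I * (1 + q*y) * ((1 - q\<^sup>2*y) * evenprod (n+1) m)
        * (x*(q\<^sup>2*y)\<^sup>2 - (1 + x*q)*(q\<^sup>2*y) - 1)"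
      unfolding telescoper_def * ** I2' by (simp only: mult_ac)
    then show ?thesis unfolding E1' by (simp add: mult_ac)
  qed
  have c: "q ^ (2*m + 3) = x * q" "q ^ (2*m + 4) = x * q\<^sup>2"
    by (simp_all add: x_def eval_nat_numeral flip: power_add power_Suc2)
  have "bailey_term m n - (1 + q ^ (2*m + 3)) * bailey_term (m + 1) n - q ^ (2*m + 4) * bailey_term (m + 2) n
    = s * E * I * ((1 - x*y\<^sup>2) * (1 + x*y*q) * (1 + x*y*q^3)
     - (1 + x*q) * (y\<^sup>2 * (1 - x*q\<^sup>2*y\<^sup>2) * (1 - x*y) * (1 + x*y*q^3))
     - x*q\<^sup>2 * (y^4 * (1 - x*q^4*y\<^sup>2) * (1 - x*y) * (1 - x*y*q\<^sup>2)))"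
    unfolding t0 t1 t2 c by (simp only: right_diff_distrib mult_ac)
  also have "\<dots> = telescoper m (n + 1) - telescoper m n"
    unfolding bailey_term_polynomial_identity g0 g1 by (simp only: right_diff_distrib)
  finally show ?thesis .
qed

section \<open>A finite form of the Jacobi triple product\<close>

fun qbinomial :: "'a::comm_ring_1 \<Rightarrow> nat \<Rightarrow> nat \<Rightarrow> 'a" where
  "qbinomial c n 0 = 1"
| "qbinomial c 0 (Suc k) = 0"
| "qbinomial c (Suc n) (Suc k) = qbinomial c n k + c ^ Suc k * qbinomial c n (Suc k)"

lemma qbinomial_eq_0: "n < k \<Longrightarrow> qbinomial c n k = 0"
  by (induction c n k rule: qbinomial.induct) auto

definition qfact :: "'a::comm_ring_1 \<Rightarrow> nat \<Rightarrow> 'a" where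
  "qfact c n = (\<Prod>i<n. 1 - c ^ Suc i)"

lemma qfact_Suc: "qfact c (Suc n) = qfact c n * (1 - c ^ Suc n)"
  by (simp add: qfact_def)

lemma qbinomial_self: "qbinomial c n n = 1"
  by (induction n) (auto simp: qbinomial_eq_0)

lemma qbinomial_qfact: "qbinomial c (a + b) a * (qfact c a * qfact c b) = qfact c (a + b)"
proof (induction "a + b" arbitrary: a b)
  case 0
  then show ?case by (simp add: qfact_def)
next
  case (Suc n)
  show ?case
  proof (cases a)
    case 0
    then show ?thesis by (simp add: qfact_def)
  next
    case a: (Suc a')
    show ?thesis
    proof (cases b)
      case 0
      then show ?thesis by (simp add: qbinomial_self qfact_def)
    next
      case b: (Suc b')
      have n: "n = a' + b" "n = a + b'" using Suc.hyps(2) a b by auto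
      have 1: "qbinomial c n a' * (qfact c a' * qfact c b) = qfact c n"
        using Suc.hyps(1)[of a' b] n(1) by simp
      have 2: "qbinomial c n a * (qfact c a * qfact c b') = qfact c n"
        using Suc.hyps(1)[of a b'] n(2) by simp
      have "qbinomial c (a + b) a * (qfact c a * qfact c b)
        = (qbinomial c n a' * (qfact c a' * qfact c b)) * (1 - c ^ a)
          + c ^ a * (1 - c ^ b) * (qbinomial c n a * (qfact c a * qfact c b'))"
      proof -
        have "qbinomial c (a + b) a = qbinomial c n a' + c ^ a * qbinomial c n a"
          unfolding Suc.hyps(2) [symmetric] by (simp add: a)
        moreover have "qfact c a = qfact c a' * (1 - c ^ a)" "qfact c b = qfact c b' * (1 - c ^ b)"
          unfolding a b by (rule qfact_Suc)+
        ultimately show ?thesis by (simp only: distrib_left distrib_right mult_ac)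
      qed
      also have "\<dots> = qfact c n * (1 - c ^ (a + b))"
        unfolding 1 2 by (simp add: algebra_simps power_add)
      also have "\<dots> = qfact c (a + b)"
        unfolding Suc.hyps(2) [symmetric] by (simp add: qfact_Suc)
      finally show ?thesis .
    qed
  qed
qed

text \<open>
  The homogeneous form, with \<open>y\<close> in place of 1, is what allows the triple product to be derived
  without negative powers. Splitting off the factor for \<open>i = 0\<close> replaces \<open>z\<close> by \<open>z * c\<close> in the others,
  which matches the Pascal rule that defines \<open>qbinomial\<close>.
\<close>

lemma qbinomial_theorem:
  "(\<Prod>i<n. y + z * c ^ i) = (\<Sum>k\<le>n. qbinomial c n k * c ^ (k choose 2) * z ^ k * y ^ (n - k))"
proof (induction n arbitrary: z)
  case 0
  then show ?case by (simp add: binomial_eq_0)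
next
  case (Suc n)
  define f where "f k = qbinomial c n k * c ^ (k choose 2) * (z * c) ^ k * y ^ (n - k)" for k
  have "(\<Prod>i<Suc n. y + z * c ^ i) = (y + z) * (\<Prod>i<n. y + (z * c) * c ^ i)"
    by (simp add: prod.lessThan_Suc_shift mult_ac del: prod.lessThan_Suc)
  also have "(\<Prod>i<n. y + (z * c) * c ^ i) = sum f {..n}"
    unfolding Suc.IH by (rule sum.cong) (simp_all add: f_def)
  also have "(y + z) * sum f {..n} = y * sum f {..n} + (\<Sum>k\<le>n. z * f k)"
    by (simp only: distrib_right sum_distrib_left [of z])
  also have "y * sum f {..n} = y * f 0 + (\<Sum>k\<le>n. y * f (Suc k))"
  proof -
    have "sum f {..n} = sum f {..Suc n}" by (simp add: f_def qbinomial_eq_0)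
    also have "\<dots> = f 0 + (\<Sum>k\<le>n. f (Suc k))" by (rule sum.atMost_Suc_shift)
    finally show ?thesis by (simp add: distrib_left sum_distrib_left)
  qed
  finally have "(\<Prod>i<Suc n. y + z * c ^ i) = y * f 0 + (\<Sum>k\<le>n. y * f (Suc k) + z * f k)"
    by (simp add: sum.distrib)
  also have "\<dots> = (\<Sum>k\<le>Suc n. qbinomial c (Suc n) k * c ^ (k choose 2) * z ^ k * y ^ (Suc n - k))"
  proof -
    have "y * f (Suc k) + z * f k
        = qbinomial c (Suc n) (Suc k) * c ^ (Suc k choose 2) * z ^ Suc k * y ^ (Suc n - Suc k)"
      if "k \<le> n" for k
    proof (cases "k = n")
      case True
      then show ?thesis
        by (simp add: f_def qbinomial_eq_0 eval_nat_numeral power_add power_mult_distrib mult_ac)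
    next
      case False
      with that have "y * y ^ (n - Suc k) = y ^ (n - k)" by (simp flip: power_Suc add: Suc_diff_Suc)
      moreover have "y * f (Suc k) = qbinomial c n (Suc k) * c ^ (Suc k choose 2) * (z * c) ^ Suc k
          * (y * y ^ (n - Suc k))" by (simp add: f_def mult_ac)
      ultimately show ?thesis
        by (simp add: f_def eval_nat_numeral power_add power_mult_distrib algebra_simps)
    qed
    moreover have "y * f 0 = qbinomial c (Suc n) 0 * c ^ (0 choose 2) * z ^ 0 * y ^ (Suc n - 0)"
      by (simp add: f_def binomial_eq_0)
    ultimately show ?thesis unfolding sum.atMost_Suc_shift by simp
  qed
  finally show ?case .
qed

lemma eight_choose_2: "8 * (k choose 2) + 4 * k = 4 * k * k"
  by (induction k) (auto simp: eval_nat_numeral)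

text \<open>
  The Jacobi triple product \<open>\<Sum>j. (-1)\<^sup>j q^(4j\<^sup>2 + 3j)\<close> has factors with negative powers of \<open>q\<close> when the
  \<open>q\<close>-binomial theorem is applied at \<open>z = -q^(7 - 8N)\<close>. Applying it at \<open>z = -1\<close>, \<open>y = q^(8N - 7)\<close> instead
  multiplies everything by one common power \<open>q^e\<close>, which cancels in the integral domain of power series.
  The index \<open>j\<close> runs over the integers: the first sum has \<open>j = n\<close>, the second has \<open>j = -(n + 1)\<close>.
\<close>

lemma finite_triple_product:
  "(\<Prod>i<N. (1 - q ^ (8*i + 7)) * (1 - q ^ (8*i + 1)))
   = (\<Sum>n\<le>N. (-1) ^ n * q ^ (4*n*n + 3*n) * qbinomial (q ^ 8) (2*N) (N + n))
   - (\<Sum>n<N. (-1) ^ n * q ^ (4*n*n + 5*n + 1) * qbinomial (q ^ 8) (2*N) (N - Suc n))"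
  (is "?P = ?A - ?B")
proof (cases "N = 0")
  case True
  then show ?thesis by simp
next
  case False
  define e where "e = 12*N*N - 11*N"
  have e: "e + 11*N = 12*N*N" using False by (cases N) (auto simp: e_def)
  define y where "y = q ^ (8*N - 7)"
  define T where "T k = qbinomial (q^8) (2*N) k * (q^8) ^ (k choose 2) * (-1) ^ k * y ^ (2*N - k)" for k
  \<comment> \<open>The factors with \<open>i < N\<close> have the larger power in \<open>y\<close>, those with \<open>i \<ge> N\<close> in \<open>(q^8)^i\<close>.\<close>
  have low: "(\<Prod>i<N. y + (-1) * (q^8) ^ i) = (-1) ^ N * q ^ (\<Sum>i<N. 8*i) * (\<Prod>i<N. 1 - q ^ (8*i + 1))"
  proof -
    have "(\<Prod>i<N. y + (-1) * (q^8) ^ i) = (\<Prod>i<N. (-1) * q ^ (8*i) * (1 - q ^ (8*(N - Suc i) + 1)))"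
    proof (rule prod.cong)
      fix i assume "i \<in> {..<N}"
      then have "y = q ^ (8*i) * q ^ (8*(N - Suc i) + 1)"
        unfolding y_def power_add [symmetric] by (intro arg_cong[where f = "power q"]) auto
      then show "y + (-1) * (q^8) ^ i = (-1) * q ^ (8*i) * (1 - q ^ (8*(N - Suc i) + 1))"
        by (simp add: right_diff_distrib flip: power_mult)
    qed simp
    also have "\<dots> = (-1) ^ N * (\<Prod>i<N. q ^ (8*i)) * (\<Prod>i<N. 1 - q ^ (8*(N - Suc i) + 1))"
      by (simp only: prod.distrib prod_constant card_lessThan)
    finally show ?thesis
      by (simp only: power_sum [symmetric] prod.nat_diff_reindex[of "\<lambda>i. 1 - q ^ (8*i + 1)"])
  qed
  have high: "(\<Prod>i<N. y + (-1) * (q^8) ^ (N + i)) = q ^ ((8*N - 7) * N) * (\<Prod>i<N. 1 - q ^ (8*i + 7))"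
  proof -
    have "y + (-1) * (q^8) ^ (N + i) = y * (1 - q ^ (8*i + 7))" for i
    proof -
      have "(q^8) ^ (N + i) = y * q ^ (8*i + 7)"
        unfolding y_def power_add [symmetric] power_mult [symmetric] using False
        by (intro arg_cong[where f = "power q"]) auto
      then show ?thesis by (simp add: algebra_simps)
    qed
    then show ?thesis by (simp add: prod.distrib y_def flip: power_mult)
  qed
  have e_eq: "(\<Sum>i<N. 8*i) + (8*N - 7) * N = e"
  proof -
    have s: "(\<Sum>i<n. 8*i) + 4*n = 4*n*n" for n :: nat
      by (induction n) (simp_all add: algebra_simps)
    have "(8*N - 7) * N + 7*N = 8*N*N" using False by (cases N) (auto simp: algebra_simps)
    moreover note s[of N]
    ultimately show ?thesis using e by linarith
  qed
  have "{..<2*N} = {..<N} \<union> (\<lambda>i. N + i) ` {..<N}"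
  proof -
    have "x \<in> (\<lambda>i. N + i) ` {..<N}" if "x < 2*N" "N \<le> x" for x
      using that by (intro image_eqI[of _ _ "x - N"]) auto
    then show ?thesis by force
  qed
  moreover have "{..<N} \<inter> (\<lambda>i. N + i) ` {..<N} = {}" by auto
  ultimately have "(\<Prod>i<2*N. y + (-1) * (q^8) ^ i)
      = (\<Prod>i<N. y + (-1) * (q^8) ^ i) * (\<Prod>i<N. y + (-1) * (q^8) ^ (N + i))"
    by (simp add: prod.union_disjoint prod.reindex)
  then have "(\<Prod>i<2*N. y + (-1) * (q^8) ^ i) = (-1) ^ N * q ^ e * ?P"
    unfolding low high e_eq [symmetric] by (simp only: prod.distrib power_add mult_ac)
  then have "(-1) ^ N * q ^ e * ?P = sum T {..2*N}"
    using qbinomial_theorem[of y "-1" "q^8" "2*N"] by (simp add: T_def)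
  also have "sum T {..2*N} = (\<Sum>n\<le>N. T (N + n)) + (\<Sum>n<N. T (N - Suc n))"
  proof -
    have "{..2*N} = {0 + N..N + N} \<union> {..<N}" "{0 + N..N + N} \<inter> {..<N} = {}" by auto
    then have "sum T {..2*N} = sum T {0 + N..N + N} + sum T {..<N}"
      by (simp only: sum.union_disjoint finite_atLeastAtMost finite_lessThan)
    also have "sum T {0 + N..N + N} = (\<Sum>n\<le>N. T (N + n))"
      unfolding sum.shift_bounds_cl_nat_ivl by (simp add: atMost_atLeast0 add.commute)
    finally show ?thesis by (simp only: sum.nat_diff_reindex)
  qed
  also have "(\<Sum>n\<le>N. T (N + n)) = (-1) ^ N * q ^ e * ?A"
    unfolding sum_distrib_left
  proof (rule sum.cong)
    fix n assume "n \<in> {..N}"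
    then obtain d where d: "N = n + d" by (auto simp: le_iff_add)
    have "8 * ((N + n) choose 2) + (8*N - 7) * (2*N - (N + n)) = e + (4*n*n + 3*n)"
    proof -
      have "2*N - (N + n) = d" using d by simp
      moreover have "(8*N - 7) * d + 7 * d = 8*N*d" using False by (cases N) (auto simp: algebra_simps)
      moreover have "8 * ((N + n) choose 2) + 4 * (N + n) = 4 * (N + n) * (N + n)"
        by (rule eight_choose_2)
      ultimately show ?thesis using e unfolding d by (simp add: algebra_simps)
    qed
    then have "(q^8) ^ ((N + n) choose 2) * y ^ (2*N - (N + n)) = q ^ e * q ^ (4*n*n + 3*n)"
      unfolding y_def power_mult [symmetric] power_add [symmetric] by simp
    then show "T (N + n) = (-1) ^ N * q ^ e * ((-1) ^ n * q ^ (4*n*n + 3*n) * qbinomial (q ^ 8) (2*N) (N + n))"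
      unfolding T_def by (simp add: power_add mult_ac)
  qed simp
  also have "(\<Sum>n<N. T (N - Suc n)) = - ((-1) ^ N * q ^ e * ?B)"
    unfolding sum_distrib_left sum_negf [symmetric]
  proof (rule sum.cong)
    fix n assume "n \<in> {..<N}"
    then obtain d where d: "N = Suc n + d" by (metis lessThan_iff less_iff_Suc_add add_Suc)
    have "8 * (d choose 2) + (8*N - 7) * (2*N - d) = e + (4*n*n + 5*n + 1)"
    proof -
      have "2*N - d = N + Suc n" using d by simp
      moreover have "(8*N - 7) * (N + Suc n) + 7 * (N + Suc n) = 8*N*(N + Suc n)"
        using False by (cases N) (auto simp: algebra_simps)
      moreover have "8 * (d choose 2) + 4 * d = 4 * d * d"
        by (rule eight_choose_2)
      ultimately show ?thesis using e unfolding d by (simp add: algebra_simps)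
    qed
    then have "(q^8) ^ (d choose 2) * y ^ (2*N - d) = q ^ e * q ^ (4*n*n + 5*n + 1)"
      unfolding y_def power_mult [symmetric] power_add [symmetric] by simp
    moreover have "N - Suc n = d" using d by simp
    moreover have "(-1) ^ d = - ((-1) ^ N * (-1) ^ n :: rat fps)"
      unfolding d by (simp add: power_add mult_ac flip: power_mult_distrib)
    ultimately show "T (N - Suc n) = - ((-1) ^ N * q ^ e *
        ((-1) ^ n * q ^ (4*n*n + 5*n + 1) * qbinomial (q ^ 8) (2*N) (N - Suc n)))"
      unfolding T_def by (simp add: mult_ac)
  qed simp
  finally have eq: "(-1) ^ N * q ^ e * ?P = (-1) ^ N * q ^ e * (?A - ?B)"
    by (simp only: right_diff_distrib add_uminus_conv_diff)
  have nz: "(-1) ^ N * q ^ e \<noteq> 0" by simp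
  from eq show ?thesis unfolding mult_left_cancel[OF nz] .
qed

section \<open>Reduction of the theta sum to a product\<close>

lemma eqmod_power_0: "N \<le> n \<Longrightarrow> eqmod (c ^ N) (c ^ n * a) 0"
  by (simp add: eqmod_0_iff le_imp_power_dvd)

lemma eqmod_power_mult:
  assumes "eqmod (c ^ b) u 1" "N \<le> a + b" shows "eqmod (c ^ N) (c ^ a * u) (c ^ a)"
proof -
  have "c ^ (a + b) dvd c ^ a * (u - 1)"
    using assms(1) unfolding eqmod_def power_add by (intro mult_dvd_mono dvd_refl)
  then have "c ^ N dvd c ^ a * (u - 1)" using le_imp_power_dvd[OF assms(2)] dvd_trans by blast
  then show ?thesis by (simp add: eqmod_def algebra_simps)
qed

lemma eqmod_one_minus_power: "N \<le> n \<Longrightarrow> eqmod (c ^ N) (1 - c ^ n) 1"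
  using eqmod_power_0[of N n c 1] by (simp add: eqmod_def)

lemma eqmod_one_plus_power: "N \<le> n \<Longrightarrow> eqmod (c ^ N) (1 + c ^ n) 1"
  using eqmod_power_0[of N n c 1] by (simp add: eqmod_def)

lemma eqmod_qfact: "r \<le> s \<Longrightarrow> eqmod (c ^ Suc r) (qfact c s) (qfact c r)"
proof (induction s rule: dec_induct)
  case (step s)
  have "eqmod (c ^ Suc r) (qfact c s * (1 - c ^ Suc s)) (qfact c r * 1)"
    using step by (intro eqmod_mult eqmod_one_minus_power) auto
  then show ?case by (simp add: qfact_Suc)
qed simp

text \<open>
  Both factorials in the denominator of the \<open>q\<close>-binomial coefficient, and those in the numerator, agree
  with \<open>qfact c r\<close> to the stated order; cancelling its square leaves 1. This makes precise that
  \<open>qfact c N * qbinomial c (2*N) k\<close> tends to 1.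
\<close>

lemma qbinomial_limit:
  assumes unit: "\<And>i. qfact c i dvd 1" and "r \<le> k" "r \<le> l" "k + l = 2 * N"
  shows "eqmod (c ^ Suc r) (qfact c N * qbinomial c (2*N) k) 1"
proof (rule eqmod_unit_cancel)
  let ?f = "qfact c r" and ?B = "qbinomial c (2*N) k"
  show "?f * ?f dvd 1" using mult_dvd_mono[OF unit unit, of r r] by simp
  have "r \<le> N" "r \<le> 2 * N" using assms by auto
  have "eqmod (c ^ Suc r) (?f * ?f * (qfact c N * ?B)) (qfact c k * qfact c l * (qfact c N * ?B))"
    using assms by (intro eqmod_mult eqmod_refl eqmod_sym[OF eqmod_qfact])
  also have "qfact c k * qfact c l * (qfact c N * ?B) = qfact c (2*N) * qfact c N"
    using qbinomial_qfact[of c k l] assms(4) by (simp add: mult_ac)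
  also have "eqmod (c ^ Suc r) \<dots> (?f * ?f)"
    using \<open>r \<le> N\<close> \<open>r \<le> 2 * N\<close> by (intro eqmod_mult eqmod_qfact)
  finally show "eqmod (c ^ Suc r) (?f * ?f * (qfact c N * ?B)) (?f * ?f * 1)" by simp
qed

lemma qfact_X_unit: "qfact (q ^ Suc j) i dvd 1"
  by (rule fps_dvd_1_if_constant_term_1) (simp add: qfact_def prod_nth_0 flip: power_mult power_Suc)

text \<open>
  The finite triple product is multiplied by \<open>qfact (q ^ 8) N\<close>. In the \<open>j\<close>-th term the cofactor is then
  1 up to order \<open>8(N - |j| + 1)\<close>, and the power \<open>q^(4j\<^sup>2 + 3j)\<close> makes up for the loss \<open>8|j|\<close>. The terms for
  \<open>j = n\<close> and \<open>j = -(n + 1)\<close> combine to the factor \<open>1 - q ^ (2*n + 1)\<close>.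
\<close>

lemma theta_product:
  "eqmod (q ^ N) (\<Sum>n<N. (-1) ^ n * q ^ (4*n*n + 3*n) * (1 - q ^ (2*n + 1)))
     (\<Prod>i<N. (1 - q ^ (8*i + 7)) * (1 - q ^ (8*i + 1)) * (1 - q ^ (8*i + 8)))"
proof -
  let ?F = "qfact (q ^ 8) N"
  let ?G = "\<lambda>k. ?F * qbinomial (q ^ 8) (2*N) k"
  have unit: "qfact (q ^ 8) i dvd 1" for i using qfact_X_unit[of 7 i] by simp
  have G: "eqmod (q ^ (8 * Suc r)) (?G k) 1" if "r \<le> k" "r \<le> l" "k + l = 2 * N" for r k l
    using qbinomial_limit[OF unit that] by (simp only: power_mult)
  have "(\<Prod>i<N. (1 - q ^ (8*i + 7)) * (1 - q ^ (8*i + 1)) * (1 - q ^ (8*i + 8)))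
      = (\<Prod>i<N. (1 - q ^ (8*i + 7)) * (1 - q ^ (8*i + 1))) * ?F"
  proof -
    have "?F = (\<Prod>i<N. 1 - q ^ (8*i + 8))"
      unfolding qfact_def power_mult [symmetric] by (intro prod.cong) (simp_all add: add.commute)
    then show ?thesis by (simp only: prod.distrib)
  qed
  also have "\<dots> = (\<Sum>n\<le>N. (-1) ^ n * (q ^ (4*n*n + 3*n) * ?G (N + n)))
       - (\<Sum>n<N. (-1) ^ n * (q ^ (4*n*n + 5*n + 1) * ?G (N - Suc n)))"
    unfolding finite_triple_product by (simp only: left_diff_distrib right_diff_distrib sum_distrib_left sum_distrib_right mult_ac)
  also have "eqmod (q ^ N) \<dots> ((\<Sum>n\<le>N. (-1) ^ n * q ^ (4*n*n + 3*n))
       - (\<Sum>n<N. (-1) ^ n * q ^ (4*n*n + 5*n + 1)))"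
  proof (intro eqmod_diff eqmod_sum eqmod_mult eqmod_refl eqmod_power_mult)
    fix n assume "n \<in> {..N}"
    then show "eqmod (q ^ (8 * Suc (N - n))) (?G (N + n)) 1"
      by (intro G[of _ _ "N - n"]) auto
    have "5 * n \<le> 4*n*n + 8" by (cases n) (auto simp: algebra_simps)
    then show "N \<le> 4*n*n + 3*n + 8 * Suc (N - n)" using \<open>n \<in> {..N}\<close> by simp
  next
    fix n assume "n \<in> {..<N}"
    then show "eqmod (q ^ (8 * Suc (N - Suc n))) (?G (N - Suc n)) 1"
      by (intro G[of _ _ "N + Suc n"]) auto
    have "3 * n \<le> 4*n*n" by (cases n) (auto simp: algebra_simps)
    then show "N \<le> 4*n*n + 5*n + 1 + 8 * Suc (N - Suc n)" using \<open>n \<in> {..<N}\<close> by simp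
  qed
  also have "(\<Sum>n\<le>N. (-1) ^ n * q ^ (4*n*n + 3*n)) - (\<Sum>n<N. (-1) ^ n * q ^ (4*n*n + 5*n + 1))
      = (\<Sum>n<N. (-1) ^ n * q ^ (4*n*n + 3*n) * (1 - q ^ (2*n + 1))) + q ^ (4*N*N + 3*N) * (-1) ^ N"
  proof -
    have "q ^ (4*n*n + 3*n) * q ^ (2*n + 1) = q ^ (4*n*n + 5*n + 1)" for n
      unfolding power_add [symmetric] by (intro arg_cong[where f = "power q"]) simp
    then have "(\<Sum>n<N. (-1) ^ n * q ^ (4*n*n + 3*n) * (1 - q ^ (2*n + 1)))
        = (\<Sum>n<N. (-1) ^ n * q ^ (4*n*n + 3*n)) - (\<Sum>n<N. (-1) ^ n * q ^ (4*n*n + 5*n + 1))"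
      by (simp only: right_diff_distrib mult_1_right mult.assoc sum_subtractf)
    then show ?thesis
      by (simp only: lessThan_Suc_atMost [symmetric] sum.lessThan_Suc) (simp add: mult.commute)
  qed
  also have "eqmod (q ^ N) \<dots> ((\<Sum>n<N. (-1) ^ n * q ^ (4*n*n + 3*n) * (1 - q ^ (2*n + 1))) + 0)"
    by (intro eqmod_add eqmod_refl eqmod_power_0) simp
  finally show ?thesis by (simp add: eqmod_sym)
qed

section \<open>The series form of the second Goellnitz-Gordon identity\<close>

lemma eqmod_second_order_recurrence:
  fixes a b \<alpha> \<beta> :: "nat \<Rightarrow> 'a::comm_ring_1"
  assumes a: "\<And>m. eqmod d (a m) (\<alpha> m * a (m + 1) + \<beta> m * a (m + 2))"
    and b: "\<And>m. eqmod d (b m) (\<alpha> m * b (m + 1) + \<beta> m * b (m + 2))"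
    and "eqmod d (a L) (b L)" "eqmod d (a (L + 1)) (b (L + 1))"
  shows "eqmod d (a 0) (b 0)"
proof -
  have "eqmod d (a (L - j)) (b (L - j)) \<and> eqmod d (a (L - j + 1)) (b (L - j + 1))" if "j \<le> L" for j
    using that
  proof (induction j)
    case 0
    then show ?case using assms by simp
  next
    case (Suc j)
    define m where "m = L - Suc j"
    have m: "L - j = m + 1" using Suc.prems by (simp add: m_def)
    have "eqmod d (a (m + 1)) (b (m + 1))" "eqmod d (a (m + 2)) (b (m + 2))"
      using Suc by (simp_all add: m)
    then have "eqmod d (\<alpha> m * a (m + 1) + \<beta> m * a (m + 2)) (\<alpha> m * b (m + 1) + \<beta> m * b (m + 2))"
      by (intro eqmod_add eqmod_mult eqmod_refl)
    then have "eqmod d (a m) (b m)" using a b eqmod_sym eqmod_trans by blast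
    with \<open>eqmod d (a (m + 1)) (b (m + 1))\<close> show ?case by (simp add: m_def)
  qed
  from this[of L] show ?thesis by simp
qed

definition bailey_sum :: "nat \<Rightarrow> nat \<Rightarrow> rat fps" where
  "bailey_sum N m = (\<Sum>n<N. bailey_term m n)"

lemma bailey_sum_recurrence:
  "eqmod (q ^ N) (bailey_sum N m) ((1 + q ^ (2*m + 3)) * bailey_sum N (m + 1) + q ^ (2*m + 4) * bailey_sum N (m + 2))"
proof -
  have "bailey_sum N m - (1 + q ^ (2*m + 3)) * bailey_sum N (m + 1) - q ^ (2*m + 4) * bailey_sum N (m + 2)
      = (\<Sum>n<N. telescoper m (Suc n) - telescoper m n)"
    unfolding bailey_sum_def sum_distrib_left sum_subtractf [symmetric] bailey_term_recurrence by simp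
  also have "\<dots> = telescoper m N" by (simp add: sum_lessThan_telescope telescoper_def[of m 0])
  also have "\<dots> = q ^ (4*N*N + 3*N + 4*m*N) * (telescoper m N div q ^ (4*N*N + 3*N + 4*m*N))"
    by (subst dvd_mult_div_cancel) (simp_all add: telescoper_def)
  finally have "bailey_sum N m - ((1 + q ^ (2*m + 3)) * bailey_sum N (m + 1) + q ^ (2*m + 4) * bailey_sum N (m + 2))
    = q ^ (4*N*N + 3*N + 4*m*N) * (telescoper m N div q ^ (4*N*N + 3*N + 4*m*N))"
    by (simp only: diff_diff_eq)
  moreover have "q ^ N dvd q ^ (4*N*N + 3*N + 4*m*N)" by (rule le_imp_power_dvd) simp
  ultimately show ?thesis unfolding eqmod_def by (metis dvd_mult2)
qed

text \<open>
  At \<open>m = 0\<close> the denominator \<open>1 + q ^ (2*n + 1)\<close> cancels, and the Bailey sum is a theta series.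
\<close>

lemma bailey_sum_0:
  "bailey_sum N 0 = (\<Sum>n<N. (-1) ^ n * q ^ (4*n*n + 3*n) * (1 - q ^ (2*n + 1)))"
  unfolding bailey_sum_def
proof (rule sum.cong)
  fix n
  have "1 - q ^ (2*0 + 2 + 4*n) = (1 - q ^ (2*n + 1)) * oddprod n 1"
    by (simp add: oddprod_def algebra_simps flip: power_add power_Suc)
  then have "bailey_term 0 n = (-1) ^ n * q ^ (4*n*n + 3*n) * (1 - q ^ (2*n + 1))
      * (oddprod n 1 * inverse (oddprod n 1))"
    by (simp add: bailey_term_def evenprod_def mult_ac)
  then show "bailey_term 0 n = (-1) ^ n * q ^ (4*n*n + 3*n) * (1 - q ^ (2*n + 1))"
    by (simp only: inverse_oddprod mult_1_right)
qed simp

text \<open>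
  The limit of \<open>ratio m\<close> is \<open>(q\<^sup>2; q\<^sup>2)\<^sub>\<infinity> / (-q; q\<^sup>2)\<^sub>\<infinity>\<close>, which is also the limit of the Bailey sums for
  large \<open>m\<close> because only the term for \<open>n = 0\<close> survives.
\<close>

definition ratio :: "nat \<Rightarrow> rat fps" where
  "ratio m = evenprod 0 m * inverse (oddprod 0 m)"

lemma ratio_Suc: "N \<le> m \<Longrightarrow> eqmod (q ^ N) (ratio (Suc m)) (ratio m)"
proof -
  assume "N \<le> m"
  have "ratio (Suc m) = evenprod 0 m * (1 - q ^ (2*m + 2)) * inverse (oddprod 0 (Suc m))"
    by (simp add: ratio_def evenprod_Suc)
  also have "eqmod (q ^ N) \<dots> (evenprod 0 m * 1 * inverse (oddprod 0 (Suc m)))"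
    using \<open>N \<le> m\<close> by (intro eqmod_mult eqmod_refl eqmod_one_minus_power) simp
  also have "eqmod (q ^ N) \<dots>
      (evenprod 0 m * 1 * (inverse (oddprod 0 (Suc m)) * (1 + q ^ (2 * (0 + m) + 1))))"
  proof (rule eqmod_mult[OF eqmod_refl eqmod_sym])
    have "eqmod (q ^ N) (inverse (oddprod 0 (Suc m)) * (1 + q ^ (2 * (0 + m) + 1)))
        (inverse (oddprod 0 (Suc m)) * 1)"
      using \<open>N \<le> m\<close> by (intro eqmod_mult eqmod_refl eqmod_one_plus_power) simp
    then show "eqmod (q ^ N) (inverse (oddprod 0 (Suc m)) * (1 + q ^ (2 * (0 + m) + 1)))
        (inverse (oddprod 0 (Suc m)))" by (simp only: mult_1_right)
  qed
  also have "evenprod 0 m * 1 * (inverse (oddprod 0 (Suc m)) * (1 + q ^ (2 * (0 + m) + 1))) = ratio m"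
    unfolding ratio_def inverse_oddprod_Suc[of 0 m] by (simp only: mult_1_right)
  finally show ?thesis .
qed

lemma bailey_sum_boundary:
  assumes "N \<le> m" shows "eqmod (q ^ N) (bailey_sum N m) (ratio (Suc m))"
proof (cases N)
  case 0
  then show ?thesis by (simp add: eqmod_def)
next
  case (Suc N')
  have "bailey_sum N m = bailey_term m 0 + (\<Sum>n<N'. bailey_term m (Suc n))"
    unfolding bailey_sum_def Suc by (rule sum.lessThan_Suc_shift)
  also have "eqmod (q ^ N) \<dots> (bailey_term m 0 + (\<Sum>n<N'. 0))"
  proof (intro eqmod_add eqmod_sum eqmod_refl)
    fix n
    define n' where "n' = Suc n"
    have "m \<le> 4 * m * n'" by (simp add: n'_def)
    then have "N \<le> 4*n'*n' + 3*n' + 4*m*n'" using assms by linarith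
    then have "q ^ N dvd q ^ (4*n'*n' + 3*n' + 4*m*n')" by (rule le_imp_power_dvd)
    then show "eqmod (q ^ N) (bailey_term m (Suc n)) 0"
      unfolding eqmod_0_iff n'_def [symmetric] bailey_term_def by (intro dvd_mult dvd_mult2)
  qed
  also have "bailey_term m 0 + (\<Sum>n<N'. 0) = ratio (Suc m)"
    by (simp add: bailey_term_def ratio_def evenprod_Suc)
  finally show ?thesis .
qed

text \<open>
  Together the two products supply \<open>1 - q\<^sup>i\<close> for all odd \<open>i\<close> and all multiples \<open>i\<close> of 4 up to \<open>8 * N\<close>. For odd
  \<open>i\<close>, \<open>(1 + q\<^sup>i)(1 - q\<^sup>i) = 1 - q\<^sup>2\<^sup>i\<close> gives the factors whose exponents are 2 modulo 4. The congruence only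
  discards those with exponents above \<open>8 * N\<close>.
\<close>

lemma product_side:
  "eqmod (q ^ N) (oddprod 0 (4*N) *
      ((\<Prod>i<N. (1 - q ^ (8*i + 7)) * (1 - q ^ (8*i + 1)) * (1 - q ^ (8*i + 8))) *
       (\<Prod>i<N. (1 - q ^ (8*i + 3)) * (1 - q ^ (8*i + 4)) * (1 - q ^ (8*i + 5)))))
    (evenprod 0 (4*N))"
proof -
  let ?E = "\<lambda>N. \<Prod>i<N. (1 - q ^ (8*i + 4)) * (1 - q ^ (8*i + 8))"
  let ?D = "\<lambda>S. \<Prod>i\<in>S. 1 - q ^ (4*i + 2)"
  have sq: "(1 + q ^ k) * (1 - q ^ k) = 1 - q ^ (2 * k)" for k
    by (simp add: distrib_right right_diff_distrib mult_2 power_add)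
  have "oddprod 0 (4*N) *
      ((\<Prod>i<N. (1 - q ^ (8*i + 7)) * (1 - q ^ (8*i + 1)) * (1 - q ^ (8*i + 8))) *
       (\<Prod>i<N. (1 - q ^ (8*i + 3)) * (1 - q ^ (8*i + 4)) * (1 - q ^ (8*i + 5))))
      = ?D {..<4*N} * ?E N" (is "_ * (?A N * ?B N) = _")
  proof (induction N)
    case 0
    then show ?case by (simp add: oddprod_def)
  next
    case (Suc N)
    have 4: "4 * Suc N = Suc (Suc (Suc (Suc (4*N))))" by simp
    have e1: "2 * (0 + 4*N) + 1 = 8*N + 1"
        "2 * (0 + Suc (4*N)) + 1 = 8*N + 3"
        "2 * (0 + Suc (Suc (4*N))) + 1 = 8*N + 5"
        "2 * (0 + Suc (Suc (Suc (4*N)))) + 1 = 8*N + 7"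
      by simp_all
    have e2: "4 * (4*N) + 2 = 2*(8*N + 1)"
        "4 * Suc (4*N) + 2 = 2*(8*N + 3)"
        "4 * Suc (Suc (4*N)) + 2 = 2*(8*N + 5)"
        "4 * Suc (Suc (Suc (4*N))) + 2 = 2*(8*N + 7)"
      by simp_all
    let ?a = "(1 + q ^ (8*N + 1)) * (1 + q ^ (8*N + 3)) * (1 + q ^ (8*N + 5)) * (1 + q ^ (8*N + 7))"
    let ?b = "(1 - q ^ (8*N + 1)) * (1 - q ^ (8*N + 3)) * (1 - q ^ (8*N + 5)) * (1 - q ^ (8*N + 7))"
    let ?c = "(1 - q ^ (8*N + 4)) * (1 - q ^ (8*N + 8))"
    have V: "oddprod 0 (4 * Suc N) = oddprod 0 (4*N) * ?a"
      unfolding 4 oddprod_Suc e1 by (simp only: mult.assoc)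
    have "?D {..<4 * Suc N} = ?D {..<4*N} *
        ((1 - q ^ (2*(8*N + 1))) * (1 - q ^ (2*(8*N + 3))) * (1 - q ^ (2*(8*N + 5))) * (1 - q ^ (2*(8*N + 7))))"
      unfolding 4 prod.lessThan_Suc e2 by (simp only: mult.assoc)
    also have "\<dots> = ?D {..<4*N} * (?a * ?b)" unfolding sq [symmetric] by (simp only: mult_ac)
    finally have D: "?D {..<4 * Suc N} = ?D {..<4*N} * (?a * ?b)" .
    have "oddprod 0 (4 * Suc N) * (?A (Suc N) * ?B (Suc N))
        = (oddprod 0 (4*N) * (?A N * ?B N)) * (?a * ?b * ?c)"
      unfolding V prod.lessThan_Suc by (simp only: mult_ac)
    also have "\<dots> = ?D {..<4 * Suc N} * ?E (Suc N)"
      unfolding Suc.IH D prod.lessThan_Suc by (simp only: mult_ac)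
    finally show ?case .
  qed
  also have "eqmod (q ^ N) \<dots> (?D {..<2*N} * ?E N)"
  proof -
    have "{..<4*N} = {..<2*N} \<union> {2*N..<4*N}" by auto
    then have "?D {..<4*N} = ?D {..<2*N} * ?D {2*N..<4*N}"
      by (simp add: prod.union_disjoint ivl_disj_int)
    moreover have "eqmod (q ^ N) (?D {2*N..<4*N}) 1"
      by (intro eqmod_prod_1 eqmod_one_minus_power) auto
    then have "eqmod (q ^ N) (?D {..<2*N} * ?D {2*N..<4*N} * ?E N) (?D {..<2*N} * 1 * ?E N)"
      by (intro eqmod_mult eqmod_refl)
    ultimately show ?thesis by (simp only: mult_1_right)
  qed
  also have "?D {..<2*N} * ?E N = evenprod 0 (4*N)"
  proof (induction N)
    case 0
    then show ?case by (simp add: evenprod_def)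
  next
    case (Suc N)
    have 4: "4 * Suc N = Suc (Suc (Suc (Suc (4*N))))" "2 * Suc N = Suc (Suc (2*N))" by simp_all
    have e3: "2 * (0 + 4*N) + 2 = 8*N + 2"
        "2 * (0 + Suc (4*N)) + 2 = 8*N + 4"
        "2 * (0 + Suc (Suc (4*N))) + 2 = 8*N + 6"
        "2 * (0 + Suc (Suc (Suc (4*N)))) + 2 = 8*N + 8"
      by simp_all
    have e4: "4 * (2*N) + 2 = 8*N + 2" "4 * Suc (2*N) + 2 = 8*N + 6"
      by simp_all
    have "evenprod 0 (4 * Suc N) = evenprod 0 (4*N) *
        ((1 - q ^ (8*N + 2)) * (1 - q ^ (8*N + 4)) * (1 - q ^ (8*N + 6)) * (1 - q ^ (8*N + 8)))"
      unfolding 4 evenprod_Suc e3 by (simp only: mult.assoc)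
    moreover have "?D {..<2 * Suc N} = ?D {..<2*N} * ((1 - q ^ (8*N + 2)) * (1 - q ^ (8*N + 6)))"
      unfolding 4 prod.lessThan_Suc e4 by (simp only: mult.assoc)
    ultimately show ?case unfolding Suc.IH [symmetric] prod.lessThan_Suc by (simp only: mult_ac)
  qed
  finally show ?thesis .
qed

text \<open>
  The recurrence runs towards smaller \<open>m\<close>, so a solution is determined by its values at two consecutive
  large indices. There \<open>a m * ratio (4*N)\<close> and the Bailey sum agree modulo \<open>q ^ N\<close>, hence they agree
  at \<open>m = 0\<close>, where the Bailey sum is a product.
\<close>

lemma goellnitz_gordon_series:
  fixes a :: "nat \<Rightarrow> rat fps"
  assumes rec: "\<And>m. a m = (1 + q ^ (2*m + 3)) * a (m + 1) + q ^ (2*m + 4) * a (m + 2)"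
    and lim: "\<And>m. eqmod (q ^ m) (a m) 1"
  shows "eqmod (q ^ N) (a 0 * (\<Prod>i<N. (1 - q ^ (8*i + 3)) * (1 - q ^ (8*i + 4)) * (1 - q ^ (8*i + 5)))) 1"
    (is "eqmod _ (_ * ?B) _")
proof -
  let ?L = "4 * N"
  let ?A = "\<Prod>i<N. (1 - q ^ (8*i + 7)) * (1 - q ^ (8*i + 1)) * (1 - q ^ (8*i + 8))"
  have *: "eqmod (q ^ N) (a m * ratio ?L) (1 * ratio ?L)" if "N \<le> m" for m
    using eqmod_weaken[OF le_imp_power_dvd[OF that] lim] by (intro eqmod_mult eqmod_refl)
  have "eqmod (q ^ N) (a 0 * ratio ?L) (bailey_sum N 0)"
  proof (rule eqmod_second_order_recurrence)
    show "eqmod (q ^ N) (a m * ratio ?L) ((1 + q ^ (2*m + 3)) * (a (m + 1) * ratio ?L)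
        + q ^ (2*m + 4) * (a (m + 2) * ratio ?L))" for m
      by (subst rec) (simp add: algebra_simps)
    have R1: "eqmod (q ^ N) (ratio ?L) (ratio (Suc ?L))"
      by (rule eqmod_sym[OF ratio_Suc]) simp
    then have R2: "eqmod (q ^ N) (ratio ?L) (ratio (Suc (Suc ?L)))"
      by (rule eqmod_trans) (rule eqmod_sym[OF ratio_Suc], simp)
    have "eqmod (q ^ N) (ratio ?L) (bailey_sum N ?L)"
      using R1 by (rule eqmod_trans) (rule eqmod_sym[OF bailey_sum_boundary], simp)
    then show "eqmod (q ^ N) (a ?L * ratio ?L) (bailey_sum N ?L)"
      using *[of ?L] by (simp only: mult_1_left) (rule eqmod_trans, simp_all)
    have "eqmod (q ^ N) (ratio ?L) (bailey_sum N (Suc ?L))"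
      using R2 by (rule eqmod_trans) (rule eqmod_sym[OF bailey_sum_boundary], simp)
    then show "eqmod (q ^ N) (a (?L + 1) * ratio ?L) (bailey_sum N (?L + 1))"
      using *[of "?L + 1"] by (simp only: mult_1_left) (rule eqmod_trans, simp_all)
  qed (rule bailey_sum_recurrence)
  also have "eqmod (q ^ N) (bailey_sum N 0) ?A" unfolding bailey_sum_0 by (rule theta_product)
  finally have "eqmod (q ^ N) (a 0 * ratio ?L * (oddprod 0 ?L * ?B)) (?A * (oddprod 0 ?L * ?B))"
    by (intro eqmod_mult eqmod_refl)
  also have "?A * (oddprod 0 ?L * ?B) = oddprod 0 ?L * (?A * ?B)" by (simp only: mult_ac)
  also have "eqmod (q ^ N) \<dots> (evenprod 0 ?L)" by (rule product_side)
  also have "a 0 * ratio ?L * (oddprod 0 ?L * ?B)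
      = evenprod 0 ?L * (a 0 * ?B) * (oddprod 0 ?L * inverse (oddprod 0 ?L))"
    unfolding ratio_def by (simp only: mult_ac)
  finally have "eqmod (q ^ N) (evenprod 0 ?L * (a 0 * ?B)) (evenprod 0 ?L * 1)"
    by (simp only: inverse_oddprod mult_1_right)
  then show ?thesis by (rule eqmod_unit_cancel[rotated]) (rule fps_dvd_1_if_constant_term_1[OF evenprod_nth_0])
qed

section \<open>Partitions with the gap condition\<close>

definition gap_partitions :: "nat \<Rightarrow> nat \<Rightarrow> nat list set" where
  "gap_partitions l n = {xs \<in> partitions n. gap_condition xs \<and> (\<forall>x \<in> set xs. l \<le> x)}"

text \<open>
  The parts that may precede a part \<open>x\<close> in a partition with the gap condition are exactly those that
  are at least \<open>next_part x\<close>: above an even \<open>x\<close>, the difference 2 would give two consecutive even parts.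
\<close>

definition next_part :: "nat \<Rightarrow> nat" where
  "next_part x = x + (if even x then 3 else 2)"

lemma finite_gap_partitions [simp]: "finite (gap_partitions l n)"
  by (rule finite_subset[OF _ finite_partitions]) (auto simp: gap_partitions_def)

lemma gap_pair_iff:
  "(int a - int b \<ge> 2 \<and> (even a \<and> even b \<longrightarrow> int a - int b > 2)) \<longleftrightarrow> next_part b \<le> a"
proof -
  have "b + 2 = a \<Longrightarrow> even b \<Longrightarrow> even a" by auto
  then show ?thesis by (auto simp: next_part_def) presburger+
qed

lemma gap_condition_next_part:
  "gap_condition xs \<longleftrightarrow> (\<forall>i. Suc i < length xs \<longrightarrow> next_part (xs ! Suc i) \<le> xs ! i)"
  unfolding gap_condition_def gap_pair_iff ..

lemma gap_condition_Cons:
  "gap_condition (x # xs) \<longleftrightarrow> (xs = [] \<or> next_part (hd xs) \<le> x) \<and> gap_condition xs"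
proof (cases xs)
  case (Cons y ys)
  show ?thesis unfolding gap_condition_next_part Cons
    by (auto simp: All_less_Suc2 less_Suc_eq_0_disj nth_Cons split: nat.splits) 
qed (simp add: gap_condition_next_part)

lemma less_next_part: "x < next_part x"
  by (auto simp: next_part_def)

lemma gap_condition_snoc:
  assumes "sorted_wrt (\<ge>) xs"
  shows "gap_condition (xs @ [x]) \<longleftrightarrow> gap_condition xs \<and> (\<forall>y \<in> set xs. next_part x \<le> y)"
  using assms
proof (induction xs)
  case (Cons y ys)
  then show ?case
    by (cases ys) (auto simp: gap_condition_Cons)
qed (simp add: gap_condition_next_part)

lemma snoc_mem_gap_partitions:
  assumes "0 < x"
  shows "xs @ [x] \<in> gap_partitions x n \<longleftrightarrow> x \<le> n \<and> xs \<in> gap_partitions (next_part x) (n - x)"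
proof -
  have "x \<le> y" if "next_part x \<le> y" for y using less_next_part[of x] that by linarith
  then show ?thesis
    using assms by (auto simp: gap_partitions_def partitions_def sorted_wrt_append gap_condition_snoc)
qed

text \<open>
  The smallest part of a partition either exceeds \<open>l\<close> or equals \<open>l\<close>, and then it can be removed.
\<close>

lemma gap_partitions_split:
  assumes "0 < l"
  shows "gap_partitions l n = gap_partitions (Suc l) n \<union>
    (if l \<le> n then (\<lambda>xs. xs @ [l]) ` gap_partitions (next_part l) (n - l) else {})"
    (is "_ = _ \<union> ?R")
proof (intro equalityI subsetI)
  fix xs assume xs: "xs \<in> gap_partitions l n"
  show "xs \<in> gap_partitions (Suc l) n \<union> ?R"
  proof (cases "l \<in> set xs")
    case False
    have "Suc l \<le> x" if "x \<in> set xs" for x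
    proof -
      have "l \<le> x" using xs that by (auto simp: gap_partitions_def)
      moreover have "l \<noteq> x" using False that by auto
      ultimately show ?thesis by simp
    qed
    then show ?thesis using xs by (auto simp: gap_partitions_def)
  next
    case True
    then obtain ys z where ys: "xs = ys @ [z]" by (metis append_butlast_last_id empty_iff set_empty)
    have "z \<le> l" "l \<le> z"
      using xs True by (auto simp: ys gap_partitions_def partitions_def sorted_wrt_append)
    then show ?thesis using xs snoc_mem_gap_partitions[OF assms] ys by auto
  qed
next
  fix xs assume "xs \<in> gap_partitions (Suc l) n \<union> ?R"
  then show "xs \<in> gap_partitions l n"
  proof
    assume "xs \<in> gap_partitions (Suc l) n"
    then show ?thesis by (auto simp: gap_partitions_def)
  next
    assume "xs \<in> ?R"
    then show ?thesis using snoc_mem_gap_partitions[OF assms] by (auto split: if_splits)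
  qed
qed

lemma card_gap_partitions:
  assumes "0 < l"
  shows "card (gap_partitions l n) = card (gap_partitions (Suc l) n) +
    (if l \<le> n then card (gap_partitions (next_part l) (n - l)) else 0)"
proof -
  have "gap_partitions (Suc l) n \<inter> (\<lambda>xs. xs @ [l]) ` A = {}" for A
    by (auto simp: gap_partitions_def)
  then show ?thesis
    unfolding gap_partitions_split[OF assms, of n]
    by (auto simp: card_Un_disjoint card_image inj_on_def)
qed

definition gap_series :: "nat \<Rightarrow> rat fps" where
  "gap_series l = Abs_fps (\<lambda>n. of_nat (card (gap_partitions l n)))"

lemma gap_series_split:
  "0 < l \<Longrightarrow> gap_series l = gap_series (Suc l) + q ^ l * gap_series (next_part l)"
  by (rule fps_ext) (simp add: gap_series_def fps_X_power_mult_nth card_gap_partitions[of l])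

text \<open>
  The smallest part is \<open>2m + 3\<close>, or \<open>2m + 4\<close>, or larger; the next part is then at least \<open>2m + 5\<close> or \<open>2m + 7\<close>,
  respectively.
\<close>

lemma gap_series_recurrence:
  "gap_series (2*m + 3) = (1 + q ^ (2*m + 3)) * gap_series (2*(m + 1) + 3)
     + q ^ (2*m + 4) * gap_series (2*(m + 2) + 3)"
proof -
  have 1: "gap_series (2*m + 3) = gap_series (2*m + 4) + q ^ (2*m + 3) * gap_series (2*(m + 1) + 3)"
    using gap_series_split[of "2*m + 3"] by (simp add: next_part_def ac_simps)
  have 2: "gap_series (2*m + 4) = gap_series (2*(m + 1) + 3) + q ^ (2*m + 4) * gap_series (2*(m + 2) + 3)"
    using gap_series_split[of "2*m + 4"] by (simp add: next_part_def ac_simps)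
  show ?thesis unfolding 1 2 by (simp only: distrib_right mult_1_left add_ac)
qed

lemma partitions_0: "partitions 0 = {[]}"
  by (auto simp: partitions_def) (metis list.set_intros(1) neq_Nil_conv less_irrefl)

lemma gap_series_limit: "eqmod (q ^ l) (gap_series l) 1"
  unfolding eqmod_fps_iff
proof (intro allI impI)
  fix n assume "n < l"
  show "fps_nth (gap_series l) n = fps_nth 1 n"
  proof (cases "n = 0")
    case True
    have "gap_partitions l 0 = {[]}"
      by (auto simp: gap_partitions_def partitions_0 gap_condition_def)
    then show ?thesis using True by (simp add: gap_series_def)
  next
    case False
    have "gap_partitions l n = {}"
    proof (rule equals0I)
      fix xs assume xs: "xs \<in> gap_partitions l n"
      then obtain x where "x \<in> set xs" using False
        by (cases xs) (auto simp: gap_partitions_def partitions_def)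
      then show False using xs \<open>n < l\<close> member_le_sum_list[of x xs]
        by (auto simp: gap_partitions_def partitions_def)
    qed
    then show ?thesis using False by (simp add: gap_series_def)
  qed
qed

section \<open>Partitions with parts in a given set\<close>

definition partitions_into :: "nat set \<Rightarrow> nat \<Rightarrow> nat list set" where
  "partitions_into S n = {xs \<in> partitions n. set xs \<subseteq> S}"

lemma finite_partitions_into [simp]: "finite (partitions_into S n)"
  by (rule finite_subset[OF _ finite_partitions]) (auto simp: partitions_into_def)

lemma partitions_into_insert:
  assumes "0 < m" and max: "\<And>x. x \<in> S \<Longrightarrow> x < m"
  shows "partitions_into (insert m S) n = partitions_into S n \<union>
    (if m \<le> n then (#) m ` partitions_into (insert m S) (n - m) else {})" (is "_ = _ \<union> ?R")
proof (intro equalityI subsetI)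
  fix xs assume xs: "xs \<in> partitions_into (insert m S) n"
  show "xs \<in> partitions_into S n \<union> ?R"
  proof (cases "m \<in> set xs")
    case False
    then show ?thesis using xs by (auto simp: partitions_into_def)
  next
    case True
    then obtain y ys where ys: "xs = y # ys" by (cases xs) auto
    have "m \<le> y" using True xs by (auto simp: ys partitions_into_def partitions_def)
    moreover have "y = m \<or> y \<in> S" using xs by (auto simp: ys partitions_into_def)
    ultimately have "y = m" using max[of y] by auto
    then show ?thesis using xs by (auto simp: ys partitions_into_def partitions_def)
  qed
next
  fix xs assume "xs \<in> partitions_into S n \<union> ?R"
  then show "xs \<in> partitions_into (insert m S) n"
    using assms by (auto simp: partitions_into_def partitions_def less_imp_le split: if_splits)
      (metis insertE less_imp_le order_refl subsetD)
qed

definition partition_series :: "nat set \<Rightarrow> rat fps" where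
  "partition_series S = Abs_fps (\<lambda>n. of_nat (card (partitions_into S n)))"

lemma partition_series_insert:
  assumes "0 < m" and max: "\<And>x. x \<in> S \<Longrightarrow> x < m"
  shows "partition_series (insert m S) * (1 - q ^ m) = partition_series S"
proof -
  have "partitions_into S n \<inter> (#) m ` A = {}" for n A
    using max[of m] by (auto simp: partitions_into_def)
  then have "card (partitions_into (insert m S) n) = card (partitions_into S n) +
      (if m \<le> n then card (partitions_into (insert m S) (n - m)) else 0)" for n
    by (subst partitions_into_insert[OF assms]) (auto simp: card_Un_disjoint card_image)
  then have "partition_series (insert m S) = partition_series S + q ^ m * partition_series (insert m S)"
    by (intro fps_ext) (simp add: partition_series_def fps_X_power_mult_nth)
  then show ?thesis by (simp add: algebra_simps)
qed

theorem partition_series_prod: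
  assumes "finite S" "\<And>x. x \<in> S \<Longrightarrow> 0 < x"
  shows "partition_series S * (\<Prod>m\<in>S. 1 - q ^ m) = 1"
  using assms
proof (induction S rule: finite_linorder_max_induct)
  case empty
  have "partitions_into {} n = (if n = 0 then {[]} else {})" for n
    by (auto simp: partitions_into_def partitions_def)
  then show ?case by (intro fps_ext) (simp add: partition_series_def)
next
  case (insert m S)
  have "partition_series (insert m S) * (\<Prod>m\<in>insert m S. 1 - q ^ m)
      = (partition_series (insert m S) * (1 - q ^ m)) * (\<Prod>m\<in>S. 1 - q ^ m)"
    using insert.hyps by (subst prod.insert) (auto simp: mult_ac)
  also have "\<dots> = 1" using insert by (subst partition_series_insert) auto
  finally show ?case .
qed

section \<open>The second Goellnitz-Gordon identity\<close>

text \<open>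
  Both generating functions, multiplied by \<open>\<Prod>m. 1 - q\<^sup>m\<close> over the \<open>m < 8N\<close> that are 3, 4 or 5
  modulo 8, give 1 modulo \<open>q ^ N\<close>. To compare the coefficients of \<open>q ^ n\<close>, \<open>N = n + 1\<close> suffices.
\<close>

theorem goellnitz_gordon:
  "card (partitions_into {x. x mod 8 \<in> {3, 4, 5}} n) = card (gap_partitions 3 n)"
proof -
  define N where "N = Suc n"
  define S where "S N = (\<Union>i<N. {8*i + 3, 8*i + 4, 8*i + 5})" for N :: nat
  have prod: "(\<Prod>m\<in>S N. 1 - q ^ m)
      = (\<Prod>i<N. (1 - q ^ (8*i + 3)) * (1 - q ^ (8*i + 4)) * (1 - q ^ (8*i + 5)))" for N
    unfolding S_def by (subst prod.UNION_disjoint) (auto simp: mult.assoc)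
  have "partition_series (S N) * (\<Prod>m\<in>S N. 1 - q ^ m) = 1"
    by (rule partition_series_prod) (auto simp: S_def)
  moreover have "eqmod (q ^ N) (gap_series 3 * (\<Prod>m\<in>S N. 1 - q ^ m)) 1"
    unfolding prod
    using goellnitz_gordon_series[of "\<lambda>m. gap_series (2*m + 3)" N, OF gap_series_recurrence]
      eqmod_weaken[OF le_imp_power_dvd gap_series_limit] by simp
  ultimately have "eqmod (q ^ N) ((\<Prod>m\<in>S N. 1 - q ^ m) * gap_series 3)
      ((\<Prod>m\<in>S N. 1 - q ^ m) * partition_series (S N))"
    by (simp add: mult.commute)
  moreover have "(\<Prod>m\<in>S N. 1 - q ^ m) dvd 1"
    using \<open>_ * _ = 1\<close> by (metis dvd_triv_right)
  ultimately have "eqmod (q ^ N) (gap_series 3) (partition_series (S N))"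
    by (metis eqmod_unit_cancel)
  then have "card (gap_partitions 3 n) = card (partitions_into (S N) n)"
    unfolding eqmod_fps_iff by (simp add: N_def gap_series_def partition_series_def)
  also have "partitions_into (S N) n = partitions_into {x. x mod 8 \<in> {3, 4, 5}} n"
  proof -
    have "x \<in> S N \<longleftrightarrow> x mod 8 \<in> {3, 4, 5}" if "x \<le> n" for x
    proof
      assume "x mod 8 \<in> {3, 4, 5}"
      then have "x = 8 * (x div 8) + 3 \<or> x = 8 * (x div 8) + 4 \<or> x = 8 * (x div 8) + 5" by auto presburger+
      moreover have "x div 8 < N" using that by (simp add: N_def)
      ultimately show "x \<in> S N" unfolding S_def by blast
    qed (auto simp: S_def)
    moreover have "x \<le> n" if "x \<in> set xs" "xs \<in> partitions n" for x xs
      using that member_le_sum_list[of x xs] by (auto simp: partitions_def)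
    ultimately show ?thesis unfolding partitions_into_def by blast
  qed
  finally show ?thesis by simp
qed

section \<open>Counting by multiplicity and by the first gap\<close>

definition add_part :: "nat \<Rightarrow> nat list \<Rightarrow> nat list" where
  "add_part m xs = rev (insort m (rev xs))"

lemma sum_list_insort: "sum_list (insort m xs) = m + sum_list (xs :: nat list)"
  by (induction xs) auto

lemma count_list_insort: "count_list (insort m xs) a = count_list (m # xs) a"
  by (induction xs) auto

lemma count_list_rev: "count_list (rev xs) a = count_list xs a"
  by (induction xs) auto

lemma count_list_add_part: "count_list (add_part m xs) m = Suc (count_list xs m)"
  by (simp add: add_part_def count_list_insort count_list_rev)

lemma inj_add_part: "inj (add_part m)"
  by (rule inj_on_inverseI[where g = "\<lambda>xs. rev (remove1 m (rev xs))"]) (simp add: add_part_def)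

lemma add_part_partitions_into:
  assumes "0 < m" "m \<in> S"
  shows "add_part m xs \<in> partitions_into S (n + m) \<longleftrightarrow> xs \<in> partitions_into S n"
proof -
  have "sorted_wrt (\<ge>) (rev (insort m (rev xs))) \<longleftrightarrow> sorted_wrt (\<ge>) xs"
    using sorted_insort[of m "rev xs"] by (simp add: sorted_wrt_rev)
  then show ?thesis
    using assms by (auto simp: partitions_into_def partitions_def add_part_def sum_list_insort set_insort_key)
qed

lemma partitions_into_count_Suc:
  assumes "0 < m" "m \<in> S"
  shows "{xs \<in> partitions_into S (n + m). Suc k \<le> count_list xs m}
     = add_part m ` {xs \<in> partitions_into S n. k \<le> count_list xs m}"
proof (intro equalityI subsetI)
  fix xs assume xs: "xs \<in> {xs \<in> partitions_into S (n + m). Suc k \<le> count_list xs m}"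
  define ys where "ys = rev (remove1 m (rev xs))"
  have "m \<in> set xs" using xs count_notin[of m xs] by (metis mem_Collect_eq not_less_eq_eq zero_le)
  moreover have "sorted (rev xs)"
    using xs by (simp add: partitions_into_def partitions_def sorted_wrt_rev)
  ultimately have "xs = add_part m ys"
    by (simp add: add_part_def ys_def insort_remove1)
  then show "xs \<in> add_part m ` {xs \<in> partitions_into S n. k \<le> count_list xs m}"
    using xs add_part_partitions_into[OF assms] by (auto simp: count_list_add_part)
qed (use add_part_partitions_into[OF assms] in \<open>auto simp: count_list_add_part\<close>)

lemma partition_part_le: "xs \<in> partitions n \<Longrightarrow> x \<in> set xs \<Longrightarrow> x \<le> n"
  using member_le_sum_list[of x xs] by (auto simp: partitions_def)

text \<open>
  Removing \<open>k\<close> copies of \<open>m\<close> is a bijection onto the partitions of \<open>n - m * k\<close>.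
\<close>

lemma card_partitions_into_count_ge:
  assumes "0 < m" "m \<in> S"
  shows "card {xs \<in> partitions_into S n. k \<le> count_list xs m}
     = (if m * k \<le> n then card (partitions_into S (n - m * k)) else 0)"
proof (induction k arbitrary: n)
  case (Suc k)
  show ?case
  proof (cases "m \<le> n")
    case True
    then obtain n' where n: "n = n' + m" by (metis add.commute le_Suc_ex)
    show ?thesis
      unfolding n partitions_into_count_Suc[OF assms]
      using Suc.IH[of n'] by (simp add: card_image inj_on_subset[OF inj_add_part])
  next
    case False
    have "{xs \<in> partitions_into S n. Suc k \<le> count_list xs m} = {}"
      using False partition_part_le[of _ n m] count_notin[of m]
      by (fastforce simp: partitions_into_def)
    then show ?thesis using False by (simp only: card.empty) auto
  qed
qed simp

lemma gap_partition_Cons2: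
  "x # y # zs \<in> gap_partitions l n \<longleftrightarrow> next_part y \<le> x \<and> x \<le> n \<and> y # zs \<in> gap_partitions l (n - x)"
  using less_next_part[of y]
  by (fastforce simp: gap_partitions_def partitions_def gap_condition_Cons)

text \<open>
  Subtracting \<open>s\<close> from the largest part alone keeps the gap condition as long as the largest part
  remains at least \<open>next_part\<close> of the second: that bound is the only constraint between them, whatever
  the parity of the largest part.
\<close>

lemma card_gap_partitions_first_gap:
  "card {xs \<in> gap_partitions l n. 2 \<le> length xs \<and> next_part (xs ! 1) + s \<le> xs ! 0}
   = (if s \<le> n then card {xs \<in> gap_partitions l (n - s). 2 \<le> length xs} else 0)"
  (is "card ?A = (if _ then card ?B else 0)")
proof (cases "s \<le> n")
  case True
  let ?f = "\<lambda>xs. (hd xs + s) # tl xs"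
  have "inj_on ?f ?B"
    by (rule inj_onI) (auto simp: gap_partitions_def intro: list.expand)
  moreover have "?A = ?f ` ?B"
  proof (intro equalityI subsetI)
    fix xs assume xs: "xs \<in> ?A"
    then obtain x y zs where "xs = x # y # zs"
      by (auto simp: numeral_2_eq_2 Suc_le_length_iff)
    then have "xs = ?f ((x - s) # y # zs)" "(x - s) # y # zs \<in> ?B"
      using xs by (auto simp: gap_partition_Cons2)
    then show "xs \<in> ?f ` ?B" by (rule image_eqI)
  next
    fix xs assume "xs \<in> ?f ` ?B"
    then obtain x y zs where "xs = (x + s) # y # zs" "x # y # zs \<in> ?B"
      by (auto simp: numeral_2_eq_2 Suc_le_length_iff)
    then show "xs \<in> ?A"
      using True by (auto simp: gap_partition_Cons2 add.commute)
  qed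
  ultimately show ?thesis using True by (simp add: card_image)
next
  case False
  have "xs ! 0 \<le> n" if "xs \<in> gap_partitions l n" "2 \<le> length xs" for xs
    using that by (intro partition_part_le[of xs] nth_mem) (auto simp: gap_partitions_def)
  then have "?A = {}" using False by fastforce
  then show ?thesis using False by (simp only: card.empty) simp
qed

lemma singleton_gap_partitions:
  "{xs \<in> gap_partitions l n. length xs = 1} = (if 0 < n \<and> l \<le> n then {[n]} else {})"
  by (auto simp: gap_partitions_def partitions_def gap_condition_def length_Suc_conv)

lemma card_gap_partitions_length_cases:
  assumes "0 < l"
  shows "card (gap_partitions l n) = (if n = 0 then 1 else 0) + (if l \<le> n then 1 else 0)
     + card {xs \<in> gap_partitions l n. 2 \<le> length xs}"
proof -
  have "gap_partitions l n = ({xs \<in> gap_partitions l n. xs = []} \<union> {xs \<in> gap_partitions l n. length xs = 1})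
      \<union> {xs \<in> gap_partitions l n. 2 \<le> length xs}" (is "_ = (?A \<union> ?B) \<union> ?C")
  proof -
    have "xs = [] \<or> length xs = 1 \<or> 2 \<le> length xs" for xs :: "nat list"
      by (cases xs) (auto simp: Suc_le_eq)
    then show ?thesis by blast
  qed
  moreover have "?A = (if n = 0 then {[]} else {})"
    by (auto simp: gap_partitions_def partitions_def gap_condition_def)
  moreover have "card (?A \<union> ?B \<union> ?C) = card ?A + card ?B + card ?C"
    by (subst card_Un_disjoint card_Un_disjoint; auto)+
  ultimately show ?thesis using assms unfolding singleton_gap_partitions by auto
qed

lemma floor_quotient_eq_iff:
  fixes x y c k M :: nat
  assumes "0 < M"
  shows "\<lfloor>(real x - real y - real c) / real M\<rfloor> = int k
     \<longleftrightarrow> y + c + M * k \<le> x \<and> x < y + c + M * Suc k"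
proof -
  have "\<lfloor>(real x - real y - real c) / real M\<rfloor> = int k \<longleftrightarrow>
      real k * real M \<le> real x - real y - real c \<and> real x - real y - real c < (real k + 1) * real M"
    using assms by (simp add: floor_eq_iff pos_le_divide_eq pos_divide_less_eq)
  also have "\<dots> \<longleftrightarrow> real (y + c + M * k) \<le> real x \<and> real x < real (y + c + M * Suc k)"
    by (auto simp: algebra_simps)
  finally show ?thesis by (simp only: of_nat_le_iff of_nat_less_iff)
qed

text \<open>
  Let \<open>G\<close> count the partitions of either kind, with value 0 at negative arguments. The left-hand side is
  \<open>G(n - Mk) - G(n - Mk - M)\<close>. On the right-hand side, the partitions with at least two parts are counted
  by the same difference for \<open>A\<close>, the contribution to \<open>G\<close> of the partitions of length at least 2. The remainder
  \<open>G - A\<close> is 1 at 0 and at each \<open>m \<ge> 3\<close>, and its difference at \<open>m = n - Mk\<close> is 1 if \<open>m = 0\<close> or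
  \<open>3 \<le> m \<le> M + 2\<close>, \<open>m \<noteq> M\<close>, and 0 otherwise: this is the condition on single parts.
\<close>

theorem theorem3p14:
  fixes M n k :: nat
  assumes "M > 0" and "M mod 8 \<in> {3, 4, 5}" and "n \<ge> 1"
  shows "card {xs \<in> partitions n. (\<forall>x \<in> set xs. x mod 8 \<in> {3, 4, 5}) \<and> count_list xs M = k} =
         card {xs \<in> partitions n. gap_condition xs \<and> (\<forall>x \<in> set xs. x \<ge> 3) \<and>
           (length xs = 1 \<longrightarrow>
              n = M * k \<or> (\<exists>j. 3 \<le> j \<and> j \<le> M + 2 \<and> j \<noteq> M \<and> n = M * k + j)) \<and>
           (length xs \<ge> 2 \<and> even (xs ! 1) \<longrightarrow>
              \<lfloor>(real (xs ! 0) - real (xs ! 1) - 3) / real M\<rfloor> = int k) \<and>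
           (length xs \<ge> 2 \<and> odd (xs ! 1) \<longrightarrow>
              \<lfloor>(real (xs ! 0) - real (xs ! 1) - 2) / real M\<rfloor> = int k)}"
    (is "card ?L = card ?R")
proof -
  let ?S = "{x. x mod 8 \<in> {3, 4, 5 :: nat}}"
  define G where "G m = card (gap_partitions 3 m)" for m
  define A where "A m = card {xs \<in> gap_partitions 3 m. 2 \<le> length xs}" for m
  define single where
    "single \<longleftrightarrow> n = M * k \<or> (\<exists>j. 3 \<le> j \<and> j \<le> M + 2 \<and> j \<noteq> M \<and> n = M * k + j)"
  have "3 \<le> M" using assms(2) by (cases "M < 3") (auto simp: less_Suc_eq numeral_3_eq_3)
  have G: "G m = (if m = 0 then 1 else 0) + (if 3 \<le> m then 1 else 0) + A m" for m
    unfolding G_def A_def by (rule card_gap_partitions_length_cases) simp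

  have ge: "card {xs \<in> partitions_into ?S n. i \<le> count_list xs M} = (if M * i \<le> n then G (n - M * i) else 0)" for i
    using card_partitions_into_count_ge[of M ?S n i] assms unfolding goellnitz_gordon G_def by simp
  have "{xs \<in> partitions_into ?S n. k \<le> count_list xs M}
      = ?L \<union> {xs \<in> partitions_into ?S n. Suc k \<le> count_list xs M}"
    by (auto simp: partitions_into_def)
  then have "card {xs \<in> partitions_into ?S n. k \<le> count_list xs M}
      = card ?L + card {xs \<in> partitions_into ?S n. Suc k \<le> count_list xs M}"
    by (simp only:) (rule card_Un_disjoint, auto intro: finite_subset[OF _ finite_partitions])
  then have L: "(if M * k \<le> n then G (n - M * k) else 0)
      = card ?L + (if M * Suc k \<le> n then G (n - M * Suc k) else 0)"
    unfolding ge .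

  define B where "B s = {xs \<in> gap_partitions 3 n. 2 \<le> length xs \<and> next_part (xs ! 1) + s \<le> xs ! 0}" for s
  have B: "card (B s) = (if s \<le> n then A (n - s) else 0)" for s
    unfolding B_def A_def by (rule card_gap_partitions_first_gap)
  let ?R2 = "{xs \<in> gap_partitions 3 n. 2 \<le> length xs \<and> next_part (xs ! 1) + M * k \<le> xs ! 0 \<and>
      xs ! 0 < next_part (xs ! 1) + M * Suc k}"
  have "B (M * k) = ?R2 \<union> B (M * Suc k)" by (auto simp: B_def)
  moreover have "card (?R2 \<union> B (M * Suc k)) = card ?R2 + card (B (M * Suc k))"
    by (rule card_Un_disjoint) (auto simp: B_def)
  ultimately have R2: "(if M * k \<le> n then A (n - M * k) else 0)
      = card ?R2 + (if M * Suc k \<le> n then A (n - M * Suc k) else 0)"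
    unfolding B [symmetric] by simp

  have "?R = {xs \<in> gap_partitions 3 n. length xs = 1 \<and> single} \<union> ?R2"
  proof -
    have "xs \<noteq> []" if "xs \<in> partitions n" for xs
      using that assms(3) by (auto simp: partitions_def)
    then have len: "length xs = 1 \<or> 2 \<le> length xs" if "xs \<in> partitions n" for xs
      using that by (cases xs) (auto simp: Suc_le_eq)
    have floor: "(even (xs ! 1) \<longrightarrow> \<lfloor>(real (xs ! 0) - real (xs ! 1) - 3) / real M\<rfloor> = int k) \<and>
        (odd (xs ! 1) \<longrightarrow> \<lfloor>(real (xs ! 0) - real (xs ! 1) - 2) / real M\<rfloor> = int k)
      \<longleftrightarrow> next_part (xs ! 1) + M * k \<le> xs ! 0 \<and> xs ! 0 < next_part (xs ! 1) + M * Suc k" for xs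
      using floor_quotient_eq_iff[OF assms(1), of "xs ! 0" "xs ! 1" 3 k]
        floor_quotient_eq_iff[OF assms(1), of "xs ! 0" "xs ! 1" 2 k]
      by (simp add: next_part_def)
    show ?thesis
    proof (intro set_eqI)
      fix xs
      show "xs \<in> ?R \<longleftrightarrow> xs \<in> {xs \<in> gap_partitions 3 n. length xs = 1 \<and> single} \<union> ?R2"
      proof (cases "length xs = 1")
        case True
        then show ?thesis by (auto simp: gap_partitions_def single_def)
      next
        case False
        then show ?thesis using len[of xs] floor[of xs]
          by (auto simp: gap_partitions_def simp del: mult_Suc_right)
      qed
    qed
  qed
  then have "card ?R = card {xs \<in> gap_partitions 3 n. length xs = 1 \<and> single} + card ?R2"
    by (simp only:) (rule card_Un_disjoint, auto)
  moreover have "card {xs \<in> gap_partitions 3 n. length xs = 1 \<and> single} = (if 3 \<le> n \<and> single then 1 else 0)"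
  proof (cases single)
    case True
    then show ?thesis using singleton_gap_partitions[of 3 n] assms(3) by simp
  qed simp
  ultimately have R: "card ?R = (if 3 \<le> n \<and> single then 1 else 0) + card ?R2" by simp

  show ?thesis
  proof (cases "M * k \<le> n")
    case False
    then have "\<not> single" by (auto simp: single_def)
    then show ?thesis using L R R2 False by simp
  next
    case True
    then obtain m where m: "n = M * k + m" using le_Suc_ex by blast
    have single: "single \<longleftrightarrow> m = 0 \<or> (3 \<le> m \<and> m \<le> M + 2 \<and> m \<noteq> M)"
      by (auto simp: single_def m)
    \<comment> \<open>A single part must itself be at least 3; this is implied, as \<open>n = M * k\<close> has \<open>k \<ge> 1\<close>.\<close>
    have "3 \<le> n" if single
    proof (cases "m = 0")
      case True
      then have "M * 1 \<le> M * k" using assms(3) by (intro mult_le_mono2) (auto simp: m Suc_le_eq)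
      then show ?thesis using \<open>3 \<le> M\<close> unfolding m by linarith
    qed (use that in \<open>auto simp: single m\<close>)
    then have R': "card ?R = (if single then 1 else 0) + card ?R2" using R by auto
    show ?thesis
    proof (cases "m < M")
      case True
      then have "G m = card ?L" "A m = card ?R2" using L R2 by (simp_all add: m)
      then show ?thesis using R' True G[of m] by (auto simp: single)
    next
      case False
      then have "G m = card ?L + G (m - M)" "A m = card ?R2 + A (m - M)" using L R2 by (simp_all add: m)
      then show ?thesis using R' False \<open>3 \<le> M\<close> G[of m] G[of "m - M"] by (auto simp: single)
    qed
  qed
qed

end
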